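(* Let $k\ge 1$ and $J\ge 1$ be integers, let $c_1,\ldots,c_k\in\mathbb{C}$ with $c_k\neq 0$, let $r_1,\ldots,r_J\in\mathbb{C}$ be distinct with $r_j\neq 0$ for all $j$, and let $p_1(n),\ldots,p_J(n)$ be polynomials in $n$ with complex coefficients. Consider the recurrence relation $$a_n + c_1 a_{n-1} + \cdots + c_k a_{n-k} = \sum_{j=1}^J p_j(n)\,r_j^n, \qquad n\ge k.$$ Let $c(t)=t^k+c_1t^{k-1}+\cdots+c_k$ be its characteristic polynomial, and for each $j$ let $s_j$ be the multiplicity of $r_j$ as a root of $c(t)$, with $s_j=0$ if $r_j$ is not a root of $c(t)$. Then there exists a particular solution of this recurrence relation of the form $$q_n=\sum_{j=1}^J b_j(n)\,n^{s_j}\,r_j^n,$$ where each $b_j(n)$ is a polynomial in $n$ with complex coefficients of the same degree as $p_j(n)$.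
   Context: All coefficients, constants and roots lie in $\mathbb{C}$. A particular solution of the recurrence relation is a complex sequence $(q_n)_{n\ge 0}$ satisfying the recurrence for all $n\ge k$ (no initial conditions are imposed). *)

theory Defs
  imports Complex_Main "HOL-Computational_Algebra.Polynomial"
begin

(* Only the values c 1, ..., c k of the coefficient function are used. *)
definition particular_solution ::
  "nat \<Rightarrow> (nat \<Rightarrow> complex) \<Rightarrow> (nat \<Rightarrow> complex) \<Rightarrow> (nat \<Rightarrow> complex) \<Rightarrow> bool" where
  "particular_solution k c f q \<longleftrightarrow>
     (\<forall>n\<ge>k. q n + (\<Sum>i=1..k. c i * q (n - i)) = f n)"

definition characteristic_poly :: "nat \<Rightarrow> (nat \<Rightarrow> complex) \<Rightarrow> complex poly" where
  "characteristic_poly k c = monom 1 k + (\<Sum>i=1..k. monom (c i) (k - i))"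

(* The library sets degree 0 = 0. The second conjunct restores the convention that the
   degree of the zero polynomial differs from that of every nonzero constant. *)
definition same_degree :: "complex poly \<Rightarrow> complex poly \<Rightarrow> bool" where
  "same_degree p q \<longleftrightarrow> degree p = degree q \<and> (p = 0 \<longleftrightarrow> q = 0)"

end

theory Submission
  imports Defs
begin

text \<open>
  Write \<open>E\<close> for the shift \<open>g(x) \<mapsto> g(x + 1)\<close> on polynomials. On sequences of the form
  \<open>g(n) r\<^sup>n\<close> the shift of sequences acts as \<open>r E\<close> on \<open>g\<close>, so the left-hand side of the recurrence,
  read at index \<open>n + k\<close>, is \<open>r\<^sup>n\<close> times the value at \<open>n\<close> of \<open>c(r E) g\<close>, where \<open>c\<close> is the
  characteristic polynomial (\<open>poly_shift_op\<close>, \<open>recurrence_lhs_eq\<close>).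
  Factor \<open>c(t) = (t - r)\<^sup>s h(t)\<close> with \<open>h(r) \<noteq> 0\<close>. The operator \<open>h(r E)\<close> multiplies the
  coefficient at the degree of \<open>g\<close> by \<open>h(r)\<close>, hence preserves degrees, and each factor
  \<open>r E - r = r (E - 1)\<close> is a nonzero multiple of the forward difference, which lowers a positive
  degree by exactly one. So \<open>c(r E)\<close> lowers all degrees \<open>\<ge> s\<close> by exactly \<open>s\<close>, and
  \<open>b \<mapsto> c(r E) (x\<^sup>s b)\<close> is a linear map that preserves degrees
  (\<open>same_degree_shift_op\<close>). Such a map is triangular with nonzero diagonal, hence surjective
  (\<open>degree_preserving_surj\<close>), and a preimage of the (shifted and scaled) polynomial \<open>p\<close> is the
  required \<open>b\<close>. The recurrence being linear, the contributions of the individual \<open>r\<^sub>j\<close> add up.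
\<close>

section \<open>Shifts and differences of polynomials\<close>

lemma coeff_pcompose_shift_top:
  fixes g :: "'a::idom poly"
  assumes "degree g \<le> n"
  shows "coeff (g \<circ>\<^sub>p [:a, 1:]) n = coeff g n"
proof (cases "degree g = n")
  case True
  then show ?thesis
    using lead_coeff_comp[of "[:a, 1:]" g] by (simp add: degree_pcompose)
next
  case False
  with assms show ?thesis
    by (simp add: coeff_eq_0 degree_pcompose)
qed

text \<open>
  The first two terms of the binomial expansion of \<open>(x + 1)\<^sup>d\<^sup>+\<^sup>1\<close>; the second one survives in the
  forward difference.
\<close>

lemma coeff_pcompose_shift_below_top:
  fixes g :: "'a::idom poly"
  assumes "degree g \<le> Suc d"
  shows "coeff (g \<circ>\<^sub>p [:1, 1:]) d = coeff g d + of_nat (Suc d) * coeff g (Suc d)"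
  using assms
proof (induction g arbitrary: d)
  case 0
  then show ?case by simp
next
  case (pCons a g)
  have deg: "degree g \<le> d"
    using pCons.prems by (cases "g = 0") auto
  note top = coeff_pcompose_shift_top[OF deg, of 1]
  show ?case
  proof (cases d)
    case 0
    then show ?thesis using top by (simp add: pcompose_pCons)
  next
    case (Suc e)
    have "coeff (g \<circ>\<^sub>p [:1, 1:]) e = coeff g e + of_nat (Suc e) * coeff g (Suc e)"
      using pCons.IH[of e] deg Suc by simp
    then show ?thesis using top Suc
      by (simp add: pcompose_pCons algebra_simps)
  qed
qed

lemma degree_forward_difference:
  fixes g :: "'a::{idom,ring_char_0} poly"
  assumes "degree g = Suc d"
  shows "degree (g \<circ>\<^sub>p [:1, 1:] - g) = d" and "g \<circ>\<^sub>p [:1, 1:] - g \<noteq> 0"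
proof -
  let ?D = "g \<circ>\<^sub>p [:1, 1:] - g"
  have "coeff ?D d = of_nat (Suc d) * lead_coeff g"
    using coeff_pcompose_shift_below_top[of g d] assms by simp
  moreover have "lead_coeff g \<noteq> 0"
    using assms by (metis degree_0 leading_coeff_0_iff nat.distinct(1))
  ultimately have nz: "coeff ?D d \<noteq> 0"
    by (simp del: of_nat_Suc)
  have "degree ?D \<le> d"
  proof (rule degree_le, intro allI impI)
    fix i assume "d < i"
    then show "coeff ?D i = 0"
      using coeff_pcompose_shift_top[of g i 1] assms by simp
  qed
  with nz show "degree ?D = d" by (meson le_antisym le_degree)
  show "?D \<noteq> 0" using nz by auto
qed

section \<open>Polynomials in the scaled shift operator\<close>

text \<open>
  This is \<open>a(r E) g\<close> for the shift \<open>E\<close>, evaluated by Horner's scheme so that identities can be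
  proved by induction on \<open>a\<close>.
\<close>

definition shift_op :: "'a::comm_ring_1 \<Rightarrow> 'a poly \<Rightarrow> 'a poly \<Rightarrow> 'a poly" where
  "shift_op r a g = fold_coeffs (\<lambda>c G. smult c g + smult r (G \<circ>\<^sub>p [:1, 1:])) a 0"

lemma shift_op_0 [simp]: "shift_op r 0 g = 0"
  by (simp add: shift_op_def)

lemma shift_op_pCons [simp]:
  "shift_op r (pCons c a) g = smult c g + smult r (shift_op r a g \<circ>\<^sub>p [:1, 1:])"
  by (cases "c = 0 \<and> a = 0") (auto simp: shift_op_def)

lemma shift_op_add_right:
  "shift_op r a (g + h) = shift_op r a g + shift_op r a h"
  by (induction a) (simp_all add: smult_add_right pcompose_add)

lemma shift_op_smult_right:
  "shift_op r a (smult u g) = smult u (shift_op r a g)"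
  by (induction a) (simp_all add: smult_add_right pcompose_smult mult.commute)

lemma shift_op_diff_left:
  "shift_op r (a - b) g = shift_op r a g - shift_op r b g"
  by (induction a b rule: poly_induct2)
    (simp_all add: smult_diff_left smult_diff_right pcompose_diff)

lemma shift_op_smult_left:
  "shift_op r (smult u a) g = smult u (shift_op r a g)"
  by (induction a) (simp_all add: smult_add_right pcompose_smult mult.commute)

text \<open>
  Substituting \<open>r E\<close> into \<open>t - r\<close> gives \<open>r (E - 1)\<close>: each root factor contributes a forward
  difference.
\<close>

lemma shift_op_linear_factor:
  "shift_op r ([:-r, 1:] * a) g = smult r (shift_op r a g \<circ>\<^sub>p [:1, 1:] - shift_op r a g)"
proof -
  have "[:-r, 1:] * a = pCons 0 a - smult r a"
    by (simp add: mult_pCons_left)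
  then show ?thesis
    by (simp only: shift_op_diff_left shift_op_smult_left shift_op_pCons)
       (simp add: smult_diff_right)
qed

lemma poly_shift_op:
  assumes "degree a \<le> k"
  shows "poly (shift_op r a g) x = (\<Sum>m\<le>k. coeff a m * r ^ m * poly g (x + of_nat m))"
  using assms
proof (induction a arbitrary: k x)
  case 0
  then show ?case by simp
next
  case (pCons c a)
  show ?case
  proof (cases k)
    case 0
    with pCons.prems have "a = 0" by (auto split: if_splits)
    with 0 show ?thesis by simp
  next
    case (Suc l)
    have "degree a \<le> l"
      using pCons.prems Suc by (cases "a = 0") auto
    note IH = pCons.IH[OF this, of "x + 1"]
    show ?thesis
      unfolding Suc sum.atMost_Suc_shift
      using IH by (simp add: poly_pcompose sum_distrib_left algebra_simps)
  qed
qed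

section \<open>The effect on degrees\<close>

text \<open>
  In top degree every shift acts as the identity, so \<open>a(r E)\<close> acts there as the scalar \<open>a(r)\<close>.
\<close>

lemma shift_op_top:
  fixes g :: "'a::idom poly"
  shows "degree (shift_op r a g) \<le> degree g"
    and "coeff (shift_op r a g) (degree g) = poly a r * lead_coeff g"
proof -
  have "degree (shift_op r a g) \<le> degree g \<and>
        coeff (shift_op r a g) (degree g) = poly a r * lead_coeff g"
  proof (induction a)
    case 0
    then show ?case by simp
  next
    case (pCons c a)
    have "degree (smult c g + smult r (shift_op r a g \<circ>\<^sub>p [:1, 1:])) \<le> degree g"
      using pCons.IH by (intro degree_add_le order.trans[OF degree_smult_le])
        (auto simp: degree_pcompose)
    then show ?case
      using pCons.IH
      by (simp add: coeff_pcompose_shift_top algebra_simps)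
  qed
  then show "degree (shift_op r a g) \<le> degree g"
    and "coeff (shift_op r a g) (degree g) = poly a r * lead_coeff g" by auto
qed

lemma degree_shift_op_root_power:
  fixes g :: "'a::{idom,ring_char_0} poly"
  assumes "r \<noteq> 0" "poly h r \<noteq> 0" "g \<noteq> 0" "s \<le> degree g"
  shows "degree (shift_op r ([:-r, 1:] ^ s * h) g) = degree g - s \<and>
         shift_op r ([:-r, 1:] ^ s * h) g \<noteq> 0"
  using assms(4)
proof (induction s)
  case 0
  have "coeff (shift_op r h g) (degree g) \<noteq> 0"
    using shift_op_top(2)[of r h g] assms by simp
  then show ?case
    using shift_op_top(1)[of r h g] le_degree by (fastforce intro: le_antisym)
next
  case (Suc s)
  let ?G = "shift_op r ([:-r, 1:] ^ s * h) g"
  have "degree ?G = Suc (degree g - Suc s)"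
    using Suc by simp
  note diff = degree_forward_difference[OF this]
  have "[:-r, 1:] ^ Suc s * h = [:-r, 1:] * ([:-r, 1:] ^ s * h)"
    by (simp only: power_Suc mult.assoc)
  then show ?case
    using diff assms(1) by (simp only: shift_op_linear_factor) simp
qed

lemma same_degree_shift_op:
  assumes "r \<noteq> 0" "a \<noteq> 0"
  shows "same_degree (shift_op r a (monom 1 (order r a) * b)) b"
proof (cases "b = 0")
  case True
  then show ?thesis
    using shift_op_smult_right[of r a 0 0] by (simp add: same_degree_def)
next
  case False
  let ?g = "monom 1 (order r a) * b"
  obtain h where h: "a = [:-r, 1:] ^ order r a * h" "\<not> [:-r, 1:] dvd h"
    using order_decomp[OF assms(2)] by blast
  have "poly h r \<noteq> 0"
    using h(2) by (simp add: poly_eq_0_iff_dvd)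
  moreover have "?g \<noteq> 0" "degree ?g = order r a + degree b"
    using False by (simp_all add: degree_mult_eq degree_monom_eq)
  ultimately have "degree (shift_op r ([:-r, 1:] ^ order r a * h) ?g) = degree b \<and>
      shift_op r ([:-r, 1:] ^ order r a * h) ?g \<noteq> 0"
    using degree_shift_op_root_power[of r h ?g "order r a"] assms(1) by simp
  then show ?thesis
    using False h(1) by (simp add: same_degree_def)
qed

text \<open>
  A degree-preserving linear map is triangular in the monomial basis with nonzero diagonal:
  matching the leading coefficient reduces a target polynomial to one of smaller degree.
\<close>

lemma degree_preserving_surj:
  fixes S :: "complex poly \<Rightarrow> complex poly"
  assumes add: "\<And>g h. S (g + h) = S g + S h"
    and smult: "\<And>u g. S (smult u g) = smult u (S g)"
    and deg: "\<And>g. same_degree (S g) g"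
  shows "\<exists>b. S b = p"
proof (induction "degree p" arbitrary: p rule: less_induct)
  case less
  let ?m = "S (monom 1 (degree p))"
  define u where "u = lead_coeff p / lead_coeff ?m"
  have m: "degree ?m = degree p" "?m \<noteq> 0"
    using deg[of "monom 1 (degree p)"] by (simp_all add: same_degree_def degree_monom_eq)
  define p' where "p' = p - smult u ?m"
  have p: "p = smult u ?m + p'" by (simp add: p'_def)
  have top: "coeff p' (degree p) = 0"
  proof -
    have "coeff ?m (degree p) \<noteq> 0"
      using m by (metis leading_coeff_0_iff)
    then show ?thesis using m(1) by (simp add: p'_def u_def)
  qed
  have le: "degree p' \<le> degree p"
    unfolding p'_def using m by (intro degree_diff_le order.trans[OF degree_smult_le]) auto
  have "\<exists>b'. S b' = p'"
  proof (cases "p' = 0")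
    case True
    then show ?thesis using smult[of 0 0] by (intro exI[of _ 0]) simp
  next
    case False
    with top le have "degree p' < degree p"
      by (metis leading_coeff_0_iff le_neq_implies_less)
    then show ?thesis by (rule less)
  qed
  then obtain b' where "S b' = p'" ..
  then have "S (smult u (monom 1 (degree p)) + b') = p"
    using p by (simp only: add smult)
  then show ?case ..
qed

section \<open>The recurrence\<close>

lemma characteristic_poly_props:
  shows "degree (characteristic_poly k c) \<le> k" and "characteristic_poly k c \<noteq> 0"
proof -
  show "degree (characteristic_poly k c) \<le> k"
    unfolding characteristic_poly_def
    by (intro degree_add_le degree_sum_le order.trans[OF degree_monom_le]) auto
  have "coeff (characteristic_poly k c) k = 1 + (\<Sum>i=1..k. coeff (monom (c i) (k - i)) k)"
    by (simp add: characteristic_poly_def coeff_sum)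
  also have "(\<Sum>i=1..k. coeff (monom (c i) (k - i)) k) = 0"
    by (intro sum.neutral) auto
  finally show "characteristic_poly k c \<noteq> 0" by auto
qed

lemma recurrence_lhs_eq:
  "q (n + k) + (\<Sum>i=1..k. c i * q (n + k - i)) =
   (\<Sum>m\<le>k. coeff (characteristic_poly k c) m * q (n + m))"
proof -
  have mono: "(\<Sum>m\<le>k. coeff (monom u j) m * q (n + m)) = u * q (n + j)" if "j \<le> k" for u j
  proof -
    have "(\<Sum>m\<le>k. coeff (monom u j) m * q (n + m)) = (\<Sum>m\<le>k. if j = m then u * q (n + m) else 0)"
      by (intro sum.cong) auto
    then show ?thesis using that by simp
  qed
  have "(\<Sum>m\<le>k. coeff (characteristic_poly k c) m * q (n + m)) =
        (\<Sum>m\<le>k. coeff (monom 1 k) m * q (n + m)) +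
        (\<Sum>m\<le>k. \<Sum>i=1..k. coeff (monom (c i) (k - i)) m * q (n + m))"
    by (simp add: characteristic_poly_def coeff_sum distrib_right sum.distrib sum_distrib_right)
  also have "(\<Sum>m\<le>k. \<Sum>i=1..k. coeff (monom (c i) (k - i)) m * q (n + m)) =
        (\<Sum>i=1..k. \<Sum>m\<le>k. coeff (monom (c i) (k - i)) m * q (n + m))"
    by (rule sum.swap)
  also have "\<dots> = (\<Sum>i=1..k. c i * q (n + k - i))"
    by (intro sum.cong refl) (simp only: mono diff_le_self, simp)
  finally show ?thesis by (simp only: mono order.refl mult_1)
qed

text \<open>
  The index of the recurrence is \<open>n + k\<close>, whereas \<open>shift_op\<close> reads the sequence forward from \<open>n\<close>;
  hence the target polynomial is \<open>r\<^sup>k p(x + k)\<close> rather than \<open>p\<close>.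
\<close>

lemma exists_particular_solution_single:
  assumes "r \<noteq> 0"
  shows "\<exists>b. same_degree b p \<and>
    particular_solution k c (\<lambda>n. poly p (of_nat n) * r ^ n)
      (\<lambda>n. poly b (of_nat n) * of_nat n ^ order r (characteristic_poly k c) * r ^ n)"
proof -
  let ?a = "characteristic_poly k c"
  let ?x = "monom 1 (order r ?a)"
  let ?S = "\<lambda>b. shift_op r ?a (?x * b)"
  let ?P = "smult (r ^ k) (p \<circ>\<^sub>p [:of_nat k, 1:])"
  have deg: "same_degree (?S b) b" for b
    using same_degree_shift_op[OF assms characteristic_poly_props(2)] .
  have "\<exists>b. ?S b = ?P"
    by (rule degree_preserving_surj[OF _ _ deg])
       (simp_all add: distrib_left shift_op_add_right shift_op_smult_right)
  then obtain b where b: "?S b = ?P" ..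
  have "same_degree b p"
    using deg[of b] assms unfolding b
    by (auto simp: same_degree_def degree_pcompose pcompose_eq_0_iff)
  moreover have "particular_solution k c (\<lambda>n. poly p (of_nat n) * r ^ n)
      (\<lambda>n. poly b (of_nat n) * of_nat n ^ order r ?a * r ^ n)" (is "particular_solution k c ?f ?q")
    unfolding particular_solution_def
  proof (intro allI impI)
    fix n' assume "k \<le> n'"
    then obtain n where n: "n' = n + k"
      by (metis add.commute le_Suc_ex)
    have "?q n' + (\<Sum>i=1..k. c i * ?q (n' - i)) = (\<Sum>m\<le>k. coeff ?a m * ?q (n + m))"
      unfolding n by (rule recurrence_lhs_eq)
    also have "\<dots> = r ^ n * poly (?S b) (of_nat n)"
      unfolding poly_shift_op[OF characteristic_poly_props(1)] sum_distrib_left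
      by (intro sum.cong) (simp_all add: poly_monom power_add mult_ac)
    also have "\<dots> = ?f n'"
      unfolding b n by (simp add: poly_pcompose power_add mult_ac add.commute)
    finally show "?q n' + (\<Sum>i=1..k. c i * ?q (n' - i)) = ?f n'" .
  qed
  ultimately show ?thesis by blast
qed

lemma particular_solution_sum:
  assumes "\<And>j. j \<in> A \<Longrightarrow> particular_solution k c (f j) (q j)"
  shows "particular_solution k c (\<lambda>n. \<Sum>j\<in>A. f j n) (\<lambda>n. \<Sum>j\<in>A. q j n)"
  unfolding particular_solution_def
proof (intro allI impI)
  fix n assume n: "k \<le> n"
  have "(\<Sum>i=1..k. c i * (\<Sum>j\<in>A. q j (n - i))) = (\<Sum>j\<in>A. \<Sum>i=1..k. c i * q j (n - i))"
    unfolding sum_distrib_left by (rule sum.swap)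
  then have "(\<Sum>j\<in>A. q j n) + (\<Sum>i=1..k. c i * (\<Sum>j\<in>A. q j (n - i))) =
      (\<Sum>j\<in>A. q j n + (\<Sum>i=1..k. c i * q j (n - i)))"
    by (simp add: sum.distrib)
  also have "\<dots> = (\<Sum>j\<in>A. f j n)"
    using assms n by (intro sum.cong) (auto simp: particular_solution_def)
  finally show "(\<Sum>j\<in>A. q j n) + (\<Sum>i=1..k. c i * (\<Sum>j\<in>A. q j (n - i))) = (\<Sum>j\<in>A. f j n)" .
qed

theorem theorem1p1:
  fixes k J :: nat
    and c :: "nat \<Rightarrow> complex"
    and r :: "nat \<Rightarrow> complex"
    and p :: "nat \<Rightarrow> complex poly"
  assumes "k \<ge> 1" and "J \<ge> 1"
    and "c k \<noteq> 0"
    and "inj_on r {1..J}"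
    and "\<forall>j\<in>{1..J}. r j \<noteq> 0"
  shows "\<exists>(q :: nat \<Rightarrow> complex) (b :: nat \<Rightarrow> complex poly).
    particular_solution k c (\<lambda>n. \<Sum>j=1..J. poly (p j) (of_nat n) * r j ^ n) q \<and>
    (\<forall>n. q n = (\<Sum>j=1..J. poly (b j) (of_nat n)
                  * of_nat n ^ order (r j) (characteristic_poly k c) * r j ^ n)) \<and>
    (\<forall>j\<in>{1..J}. same_degree (b j) (p j))"
proof -
  have "\<forall>j\<in>{1..J}. \<exists>b. same_degree b (p j) \<and>
    particular_solution k c (\<lambda>n. poly (p j) (of_nat n) * r j ^ n)
      (\<lambda>n. poly b (of_nat n) * of_nat n ^ order (r j) (characteristic_poly k c) * r j ^ n)"
    using assms(5) exists_particular_solution_single by blast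
  then obtain b where b: "\<forall>j\<in>{1..J}. same_degree (b j) (p j) \<and>
    particular_solution k c (\<lambda>n. poly (p j) (of_nat n) * r j ^ n)
      (\<lambda>n. poly (b j) (of_nat n) * of_nat n ^ order (r j) (characteristic_poly k c) * r j ^ n)"
    by (rule bchoice[THEN exE])
  let ?q = "\<lambda>n. \<Sum>j=1..J. poly (b j) (of_nat n)
                  * of_nat n ^ order (r j) (characteristic_poly k c) * r j ^ n"
  have "particular_solution k c (\<lambda>n. \<Sum>j=1..J. poly (p j) (of_nat n) * r j ^ n) ?q"
    using b by (intro particular_solution_sum) auto
  with b show ?thesis by blast
qed

end
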